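(* The sets $\mathcal{Y}_1=\{S_2\}$, $\mathcal{N}_{1,1}=\{S_3\}$ and $\mathcal{N}_{1,2}=\{L_2\}$ form a characterizing collection of winners and losers for size $1$ teams; that is, $\mathcal{Y}_1$ is a winning team, $\mathcal{N}_{1,1}$ and $\mathcal{N}_{1,2}$ are losing teams, and for every team $\mathcal{F}$ with exactly $1$ element, either $\mathcal{F}\preceq\mathcal{Y}_1$ or $\mathcal{N}_{1,i}\preceq\mathcal{F}$ for some $i\in\{1,2\}$. (Consequently a team of size $1$ is a winner if and only if it is simpler than $\mathcal{Y}_1$.)
   Context: Board and polyominoes. The cells are the translates of the unit square $[0,1]\times[0,1]$ by vectors of $\mathbf{Z}^2$; identify a cell with the vector in $\mathbf{Z}^2$. Two cells are adjacent if they share an edge. A polyomino is a nonempty (finite or infinite) set of cells that is connected through adjacent cells, considered up to congruence (translations, rotations, reflections of the board). Game. Two players, maker (moving first) and breaker, alternately mark previously unmarked cells of the infinite board: in each turn the maker marks 1 cell and the breaker marks 2 cells. For a set $\mathcal{S}$ of finite polyominoes, the maker wins if after finitely many moves he has marked all the cells of a set congruent to some element of $\mathcal{S}$; the breaker wins if she prevents this. $\mathcal{S}$ is a winner (winning) if the maker has a winning strategy. Ancestors. $P\sqsubseteq Q$ ($P$ is an ancestor of $Q$) means that some congruent copy of $P$ is a subset of $Q$. A team is a set of polyominoes no element of which is an ancestor of another element; its size is its number of elements. Unbounded sets. A set of polyominoes is unbounded if it contains an infinite polyomino. If $\mathcal{T}$ is unbounded and $F_T$ is a finite ancestor of $T$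 for each $T\in\mathcal{T}$, then $\{F_T\mid T\in\mathcal{T}\}$ is a bounded restriction of $\mathcal{T}$. An unbounded set is a winner if each of its bounded restrictions is a winner. A set that is not a winner is a loser (losing). Simpler. $\mathcal{S}\preceq\mathcal{T}$ ($\mathcal{S}$ is simpler than $\mathcal{T}$) means that for all $Q\in\mathcal{T}$ there is $P\in\mathcal{S}$ with $P\sqsubseteq Q$. Particular polyominoes (up to congruence): $S_n=\{(0,0),\dots,(n-1,0)\}$; $L_2=\{(0,0),(1,0),(0,1)\}$. *)

theory Defs
  imports Main
begin

text \<open>A cell is identified with the integer vector at its lower left corner.\<close>

type_synonym cell = "int \<times> int"

text \<open>Two unit squares of the board share an edge iff their vectors differ by a unit vector.\<close>

definition adjacent :: "cell \<Rightarrow> cell \<Rightarrow> bool" where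
  "adjacent p q \<longleftrightarrow> \<bar>fst p - fst q\<bar> + \<bar>snd p - snd q\<bar> = 1"

definition cell_connected :: "cell set \<Rightarrow> bool" where
  "cell_connected P \<longleftrightarrow>
     (\<forall>p\<in>P. \<forall>q\<in>P. (p, q) \<in> {(u, v). u \<in> P \<and> v \<in> P \<and> adjacent u v}\<^sup>*)"

text \<open>
  The symmetries of the board, acting on cells: the maps generated by the translations, a
  quarter turn and a reflection.  The quarter turn and the reflection fix the centre of the cell
  (0, 0); those about other admissible centres and axes arise by composing with translations.
\<close>

inductive_set board_symmetries :: "(cell \<Rightarrow> cell) set" where
  identity: "(\<lambda>p. p) \<in> board_symmetries"
| translate: "f \<in> board_symmetries \<Longrightarrow> (\<lambda>p. (fst (f p) + a, snd (f p) + b)) \<in> board_symmetries"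
| rotate: "f \<in> board_symmetries \<Longrightarrow> (\<lambda>p. (- snd (f p), fst (f p))) \<in> board_symmetries"
| reflect: "f \<in> board_symmetries \<Longrightarrow> (\<lambda>p. (- fst (f p), snd (f p))) \<in> board_symmetries"

definition congruent :: "cell set \<Rightarrow> cell set \<Rightarrow> bool" where
  "congruent P Q \<longleftrightarrow> (\<exists>f\<in>board_symmetries. f ` P = Q)"

text \<open>
  Polyominoes are handled through representatives: a polyomino is a concrete set of cells, and
  every notion below is invariant under congruence.  Distinct congruent sets are ancestors of
  each other, so a team contains at most one representative of each congruence class and its
  cardinality is the number of its polyominoes up to congruence.
\<close>

definition polyomino :: "cell set \<Rightarrow> bool" where
  "polyomino P \<longleftrightarrow> P \<noteq> {} \<and> cell_connected P"

definition ancestor :: "cell set \<Rightarrow> cell set \<Rightarrow> bool" (infix "\<sqsubseteq>" 50) where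
  "P \<sqsubseteq> Q \<longleftrightarrow> (\<exists>P'. congruent P P' \<and> P' \<subseteq> Q)"

definition team :: "cell set set \<Rightarrow> bool" where
  "team T \<longleftrightarrow> (\<forall>P\<in>T. polyomino P) \<and> (\<forall>P\<in>T. \<forall>Q\<in>T. P \<noteq> Q \<longrightarrow> \<not> P \<sqsubseteq> Q)"

definition simpler :: "cell set set \<Rightarrow> cell set set \<Rightarrow> bool" (infix "\<preceq>" 50) where
  "S \<preceq> T \<longleftrightarrow> (\<forall>Q\<in>T. \<exists>P\<in>S. P \<sqsubseteq> Q)"

text \<open>
  A strategy of the maker yields his next cell from the list of the breaker's replies so far
  (oldest first); his own earlier moves are determined by these.  In round \<open>k\<close>, counted from 0,
  the maker marks one cell and then the breaker marks the two cells of \<open>b k\<close>.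
\<close>

type_synonym strategy = "cell set list \<Rightarrow> cell"

definition maker_move :: "strategy \<Rightarrow> (nat \<Rightarrow> cell set) \<Rightarrow> nat \<Rightarrow> cell" where
  "maker_move \<sigma> b k = \<sigma> (map b [0..<k])"

definition maker_cells :: "strategy \<Rightarrow> (nat \<Rightarrow> cell set) \<Rightarrow> nat \<Rightarrow> cell set" where
  "maker_cells \<sigma> b n = maker_move \<sigma> b ` {..<n}"

definition breaker_cells :: "(nat \<Rightarrow> cell set) \<Rightarrow> nat \<Rightarrow> cell set" where
  "breaker_cells b n = (\<Union>k<n. b k)"

definition maker_legal :: "strategy \<Rightarrow> (nat \<Rightarrow> cell set) \<Rightarrow> nat \<Rightarrow> bool" where
  "maker_legal \<sigma> b k \<longleftrightarrow> maker_move \<sigma> b k \<notin> maker_cells \<sigma> b k \<union> breaker_cells b k"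

definition breaker_legal :: "strategy \<Rightarrow> (nat \<Rightarrow> cell set) \<Rightarrow> nat \<Rightarrow> bool" where
  "breaker_legal \<sigma> b k \<longleftrightarrow>
     card (b k) = 2 \<and> b k \<inter> (maker_cells \<sigma> b (Suc k) \<union> breaker_cells b k) = {}"

text \<open>
  The breaker's replies are taken as infinite sequences.  Since the board is infinite, every
  finite sequence of legal replies extends to one; what happens after the maker has won is
  irrelevant, so his moves only have to be legal up to that point.
\<close>

definition winning_strategy :: "cell set set \<Rightarrow> strategy \<Rightarrow> bool" where
  "winning_strategy S \<sigma> \<longleftrightarrow>
     (\<forall>b. (\<forall>k. breaker_legal \<sigma> b k) \<longrightarrow>
       (\<exists>n. (\<forall>k<n. maker_legal \<sigma> b k) \<and>
            (\<exists>P\<in>S. \<exists>P'. congruent P P' \<and> P' \<subseteq> maker_cells \<sigma> b n)))"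

definition unbounded :: "cell set set \<Rightarrow> bool" where
  "unbounded T \<longleftrightarrow> (\<exists>P\<in>T. infinite P)"

definition bounded_restriction :: "cell set set \<Rightarrow> cell set set \<Rightarrow> bool" where
  "bounded_restriction T R \<longleftrightarrow> unbounded T \<and>
     (\<exists>F. (\<forall>P\<in>T. polyomino (F P) \<and> finite (F P) \<and> F P \<sqsubseteq> P) \<and> R = F ` T)"

definition winner :: "cell set set \<Rightarrow> bool" where
  "winner S \<longleftrightarrow>
     (if unbounded S
      then (\<forall>R. bounded_restriction S R \<longrightarrow> (\<exists>\<sigma>. winning_strategy R \<sigma>))
      else (\<exists>\<sigma>. winning_strategy S \<sigma>))"

abbreviation loser :: "cell set set \<Rightarrow> bool" where
  "loser S \<equiv> \<not> winner S"

definition characterizing_collection ::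
    "nat \<Rightarrow> cell set set set \<Rightarrow> cell set set set \<Rightarrow> bool" where
  "characterizing_collection n \<Y> \<N> \<longleftrightarrow>
     (\<forall>Y\<in>\<Y>. team Y \<and> winner Y) \<and>
     (\<forall>N\<in>\<N>. team N \<and> loser N) \<and>
     (\<forall>F. team F \<and> finite F \<and> card F = n \<longrightarrow> (\<exists>Y\<in>\<Y>. F \<preceq> Y) \<or> (\<exists>N\<in>\<N>. N \<preceq> F))"

definition S_poly :: "nat \<Rightarrow> cell set" where
  "S_poly n = {(int i, 0) | i. i < n}"

definition L2_poly :: "cell set" where
  "L2_poly = {(0, 0), (1, 0), (0, 1)}"

definition Y1 :: "cell set set" where "Y1 = {S_poly 2}"
definition N11 :: "cell set set" where "N11 = {S_poly 3}"
definition N12 :: "cell set set" where "N12 = {L2_poly}"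

end

theory Submission
  imports Defs
begin

text \<open>
  The maker completes a domino because only two of the four neighbours of his first cell can be
  taken from him at once.  The breaker wins by a pairing in which every cell has two partners: she
  answers each cell with its partners, so the maker never owns two partners.  Against the straight
  tromino she partitions the rows and the columns into dominoes, against the bent one she
  takes the horizontal neighbours as partners.  Finally, a polyomino with at least three cells has a
  cell with two neighbours, hence contains one of the two trominoes.
\<close>

section \<open>Symmetries of the board and the ancestor relation\<close>

lemma board_symmetries_comp:
  "g \<in> board_symmetries \<Longrightarrow> f \<in> board_symmetries \<Longrightarrow> (\<lambda>p. g (f p)) \<in> board_symmetries"
  by (induction rule: board_symmetries.induct) (auto intro: board_symmetries.intros)

text \<open>The linear part is a signed permutation matrix, a form that each generator preserves. It
  makes the image of a tromino under an arbitrary symmetry an explicit list of three cells.\<close>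

lemma board_symmetries_affine:
  assumes "f \<in> board_symmetries"
  obtains x y a b c d where
    "\<And>p. f p = (x + a * fst p + b * snd p, y + c * fst p + d * snd p)"
    "b = 0 \<and> c = 0 \<and> \<bar>a\<bar> = 1 \<and> \<bar>d\<bar> = 1 \<or> a = 0 \<and> d = 0 \<and> \<bar>b\<bar> = 1 \<and> \<bar>c\<bar> = 1"
proof -
  have "\<exists>x y a b c d. (\<forall>p. f p = (x + a * fst p + b * snd p, y + c * fst p + d * snd p)) \<and>
    (b = 0 \<and> c = 0 \<and> \<bar>a\<bar> = 1 \<and> \<bar>d\<bar> = 1 \<or> a = 0 \<and> d = 0 \<and> \<bar>b\<bar> = 1 \<and> \<bar>c\<bar> = 1)"
    (is "\<exists>x y a b c d. ?A f x y a b c d")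
    using assms
  proof induction
    case identity
    have "?A (\<lambda>p. p) 0 0 1 0 0 1" by simp
    then show ?case by blast
  next
    case (translate f s t)
    then obtain x y a b c d where "?A f x y a b c d" by blast
    then have "?A (\<lambda>p. (fst (f p) + s, snd (f p) + t)) (x + s) (y + t) a b c d" by simp
    then show ?case by blast
  next
    case (rotate f)
    then obtain x y a b c d where "?A f x y a b c d" by blast
    then have "?A (\<lambda>p. (- snd (f p), fst (f p))) (- y) x (- c) (- d) a b" by auto
    then show ?case by blast
  next
    case (reflect f)
    then obtain x y a b c d where "?A f x y a b c d" by blast
    then have "?A (\<lambda>p. (- fst (f p), snd (f p))) (- x) y (- a) (- b) c d" by auto
    then show ?case by blast
  qed
  then show thesis using that by blast
qed

text \<open>In complex notation this is multiplication by the Gaussian unit \<open>d + e i\<close>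
  followed by a translation. It sends the direction (1, 0) to (d, e), which is how copies of the
  domino and the trominoes are placed below.\<close>

lemma board_symmetries_turn:
  assumes "\<bar>d\<bar> + \<bar>e\<bar> = 1"
  shows "(\<lambda>p. (d * fst p - e * snd p + x, e * fst p + d * snd p + y)) \<in> board_symmetries"
proof -
  note rot = board_symmetries.rotate
  have r0: "(\<lambda>p. p) \<in> board_symmetries" by (rule board_symmetries.identity)
  have r1: "(\<lambda>p. (- snd p, fst p)) \<in> board_symmetries" using rot[OF r0] by simp
  have r2: "(\<lambda>p. (- fst p, - snd p)) \<in> board_symmetries" using rot[OF r1] by simp
  have r3: "(\<lambda>p. (snd p, - fst p)) \<in> board_symmetries" using rot[OF r2] by simp
  have "d = 1 \<and> e = 0 \<or> d = 0 \<and> e = 1 \<or> d = -1 \<and> e = 0 \<or> d = 0 \<and> e = -1"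
    using assms by arith
  then show ?thesis
    using board_symmetries.translate[OF r0, of x y] board_symmetries.translate[OF r1, of x y]
      board_symmetries.translate[OF r2, of x y] board_symmetries.translate[OF r3, of x y]
    by (elim disjE) (simp_all add: algebra_simps)
qed

lemma ancestorI: "f \<in> board_symmetries \<Longrightarrow> f ` P \<subseteq> Q \<Longrightarrow> P \<sqsubseteq> Q"
  unfolding ancestor_def congruent_def by blast

lemma ancestorE:
  assumes "P \<sqsubseteq> Q"
  obtains f where "f \<in> board_symmetries" "f ` P \<subseteq> Q"
  using assms unfolding ancestor_def congruent_def by blast

lemma ancestor_trans:
  assumes "P \<sqsubseteq> Q" "Q \<sqsubseteq> R"
  shows "P \<sqsubseteq> R"
proof -
  obtain f where f: "f \<in> board_symmetries" "f ` P \<subseteq> Q" using assms(1) by (rule ancestorE)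
  obtain g where g: "g \<in> board_symmetries" "g ` Q \<subseteq> R" using assms(2) by (rule ancestorE)
  show ?thesis
    by (rule ancestorI[OF board_symmetries_comp[OF g(1) f(1)]]) (use f g in blast)
qed

lemma board_symmetries_inj:
  assumes "f \<in> board_symmetries"
  shows "inj f"
  using assms unfolding inj_def by induction (blast, (metis prod_eqI add_right_imp_eq
    neg_equal_iff_equal fst_conv snd_conv)+)

lemma ancestor_finite:
  assumes "P \<sqsubseteq> Q" "finite Q"
  shows "finite P"
proof -
  obtain f where "f \<in> board_symmetries" "f ` P \<subseteq> Q" using assms(1) by (rule ancestorE)
  then show ?thesis
    using assms(2) board_symmetries_inj finite_imageD finite_subset inj_on_subset subset_UNIV
    by metis
qed

lemma winning_strategy_iff:
  "winning_strategy S \<sigma> \<longleftrightarrow>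
     (\<forall>b. (\<forall>k. breaker_legal \<sigma> b k) \<longrightarrow>
       (\<exists>n. (\<forall>k<n. maker_legal \<sigma> b k) \<and> (\<exists>P\<in>S. P \<sqsubseteq> maker_cells \<sigma> b n)))"
  unfolding winning_strategy_def ancestor_def by blast

lemma winning_strategy_simpler:
  assumes "S \<preceq> T" "winning_strategy T \<sigma>"
  shows "winning_strategy S \<sigma>"
  using assms ancestor_trans unfolding winning_strategy_iff simpler_def by meson

section \<open>Small polyominoes: the domino, the two trominoes and what contains them\<close>

lemma S_poly_numeral:
  "S_poly 2 = {(0, 0), (1, 0)}" "S_poly 3 = {(0, 0), (1, 0), (2, 0)}"
proof -
  have "S_poly n = (\<lambda>i. (int i, 0)) ` {..<n}" for n
    unfolding S_poly_def by blast
  then show "S_poly 2 = {(0, 0), (1, 0)}" "S_poly 3 = {(0, 0), (1, 0), (2, 0)}"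
    by (auto simp: numeral_eq_Suc lessThan_Suc)
qed

lemma S2_ancestor:
  assumes "p \<in> Q" "q \<in> Q" "adjacent p q"
  shows "S_poly 2 \<sqsubseteq> Q"
proof (rule ancestorI[OF board_symmetries_turn])
  show "\<bar>fst q - fst p\<bar> + \<bar>snd q - snd p\<bar> = 1"
    using assms(3) unfolding adjacent_def by arith
  show "(\<lambda>r. ((fst q - fst p) * fst r - (snd q - snd p) * snd r + fst p,
              (snd q - snd p) * fst r + (fst q - fst p) * snd r + snd p)) ` S_poly 2 \<subseteq> Q"
    using assms(1,2) by (simp add: S_poly_numeral)
qed

lemma ancestor_S2:
  assumes "adjacent p q" "P \<subseteq> {p, q}"
  shows "P \<sqsubseteq> S_poly 2"
proof -
  define d e where "d = fst q - fst p" and "e = snd q - snd p"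
  have de: "d = 1 \<and> e = 0 \<or> d = 0 \<and> e = 1 \<or> d = -1 \<and> e = 0 \<or> d = 0 \<and> e = -1"
    using assms(1) unfolding adjacent_def d_def e_def by arith
  have q: "q = (fst p + d, snd p + e)" by (simp add: d_def e_def)
  have "{p, q} \<sqsubseteq> S_poly 2"
  \<comment> \<open>The inverse turn, by the conjugate unit \<open>d - e i\<close>, with the
    translation chosen so that \<open>p\<close> goes to the origin; then \<open>q\<close> goes to
    (1, 0).\<close>
  proof (rule ancestorI[OF board_symmetries_turn])
    show "\<bar>d\<bar> + \<bar>- e\<bar> = 1" using de by auto
    show "(\<lambda>r. (d * fst r - (- e) * snd r + (- d * fst p - e * snd p),
                (- e) * fst r + d * snd r + (e * fst p - d * snd p))) ` {p, q} \<subseteq> S_poly 2"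
      using de by (auto simp: S_poly_numeral q)
  qed
  moreover have "P \<sqsubseteq> {p, q}"
    by (rule ancestorI[OF board_symmetries.identity]) (use assms(2) in simp)
  ultimately show ?thesis using ancestor_trans by blast
qed

lemma two_neighbours:
  assumes "p \<in> Q" "q \<in> Q" "r \<in> Q" "adjacent p q" "adjacent p r" "q \<noteq> r"
  shows "S_poly 3 \<sqsubseteq> Q \<or> L2_poly \<sqsubseteq> Q"
proof -
  define d e where "d = fst q - fst p" and "e = snd q - snd p"
  define d' e' where "d' = fst r - fst p" and "e' = snd r - snd p"
  have de: "d = 1 \<and> e = 0 \<or> d = 0 \<and> e = 1 \<or> d = -1 \<and> e = 0 \<or> d = 0 \<and> e = -1"
    using assms(4) unfolding adjacent_def d_def e_def by arith
  have de': "d' = 1 \<and> e' = 0 \<or> d' = 0 \<and> e' = 1 \<or> d' = -1 \<and> e' = 0 \<or> d' = 0 \<and> e' = -1"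
    using assms(5) unfolding adjacent_def d'_def e'_def by arith
  have q: "q = (fst p + d, snd p + e)" by (simp add: d_def e_def)
  have r: "r = (fst p + d', snd p + e')" by (simp add: d'_def e'_def)
  have ne: "\<not> (d = d' \<and> e = e')" using assms(6) q r by auto
  have pQ: "(fst p, snd p) \<in> Q" "(fst p + d, snd p + e) \<in> Q" "(fst p + d', snd p + e') \<in> Q"
    using assms(1-3) q r by auto
  have unit: "\<bar>d\<bar> + \<bar>e\<bar> = 1" "\<bar>d'\<bar> + \<bar>e'\<bar> = 1" using de de' by auto
  \<comment> \<open>Two distinct unit vectors are opposite, or one is the counterclockwise quarter
    turn of the other. In the last two cases the vector that gets turned serves as the image of (1,
    0).\<close>
  consider "d' = - d" "e' = - e" | "d' = - e" "e' = d" | "d = - e'" "e = d'"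
    using de de' ne by auto
  then show ?thesis
  proof cases
    case 1
    have "S_poly 3 \<sqsubseteq> Q"
      \<comment> \<open>The straight tromino starts at \<open>r\<close>, so that \<open>p\<close> is
        its middle cell.\<close>
      by (rule ancestorI[OF board_symmetries_turn[OF unit(1), of "fst p - d" "snd p - e"]])
        (use pQ 1 in \<open>simp add: S_poly_numeral algebra_simps\<close>)
    then show ?thesis ..
  next
    case 2
    have "L2_poly \<sqsubseteq> Q"
      by (rule ancestorI[OF board_symmetries_turn[OF unit(1), of "fst p" "snd p"]])
        (use pQ 2 in \<open>simp add: L2_poly_def algebra_simps\<close>)
    then show ?thesis ..
  next
    case 3
    have "L2_poly \<sqsubseteq> Q"
      by (rule ancestorI[OF board_symmetries_turn[OF unit(2), of "fst p" "snd p"]])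
        (use pQ 3 in \<open>simp add: L2_poly_def algebra_simps\<close>)
    then show ?thesis ..
  qed
qed

lemma adjacent_sym: "adjacent p q \<longleftrightarrow> adjacent q p"
  unfolding adjacent_def by (simp add: abs_minus_commute)

text \<open>A path from a cell of \<open>A\<close> to a cell outside \<open>A\<close> has a first
  step that leaves \<open>A\<close>. This serves to grow a polyomino cell by cell.\<close>

lemma cell_connected_boundary:
  assumes "cell_connected P" "A \<subseteq> P" "A \<noteq> {}" "A \<noteq> P"
  obtains u v where "u \<in> A" "v \<in> P" "v \<notin> A" "adjacent u v"
proof -
  obtain a b where a: "a \<in> A" and b: "b \<in> P" "b \<notin> A" using assms(2-4) by blast
  have "(a, b) \<in> {(u, v). u \<in> P \<and> v \<in> P \<and> adjacent u v}\<^sup>*"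
    using assms(1,2) a b unfolding cell_connected_def by blast
  then have "b \<in> A \<or> (\<exists>u v. u \<in> A \<and> v \<in> P \<and> v \<notin> A \<and> adjacent u v)"
    by induction (use a in auto)
  then show thesis using that b by blast
qed

lemma polyomino_cases:
  assumes "polyomino P"
  shows "P \<sqsubseteq> S_poly 2 \<or> S_poly 3 \<sqsubseteq> P \<or> L2_poly \<sqsubseteq> P"
proof -
  obtain p where p: "p \<in> P" and conn: "cell_connected P"
    using assms unfolding polyomino_def by blast
  show ?thesis
  proof (cases "P = {p}")
    case True
    \<comment> \<open>A single cell is treated as part of a domino; the choice of the neighbour is
      arbitrary.\<close>
    have "adjacent p (fst p + 1, snd p)" by (simp add: adjacent_def)
    then show ?thesis using ancestor_S2 True by blast
  next
    case False
    obtain q where q: "q \<in> P" "adjacent p q" "p \<noteq> q"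
      by (rule cell_connected_boundary[OF conn, of "{p}"]) (use p False in auto)
    show ?thesis
    proof (cases "P = {p, q}")
      case True
      then show ?thesis using ancestor_S2 q(2) by blast
    next
      case False
      obtain u r where "u \<in> {p, q}" "r \<in> P" "r \<notin> {p, q}" "adjacent u r"
        by (rule cell_connected_boundary[OF conn, of "{p, q}"]) (use False p q in auto)
      \<comment> \<open>If \<open>u = p\<close>, then \<open>p\<close> has the neighbours
        \<open>q\<close> and \<open>r\<close>; if \<open>u = q\<close>, then \<open>q\<close> has
        the neighbours \<open>p\<close> and \<open>r\<close>.\<close>
      then show ?thesis using two_neighbours p q adjacent_sym by (metis insertE insertCI singletonD)
    qed
  qed
qed

section \<open>The maker's win with the domino\<close>

lemma S2_winning_strategy: "\<exists>\<sigma>. winning_strategy {S_poly 2} \<sigma>"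
proof -
  define \<sigma> :: strategy where
    \<comment> \<open>\<open>hd bs\<close> is the breaker's first reply. Only the first two moves
      matter, since the domino is then complete.\<close>
    "\<sigma> bs = (if bs = [] then (0, 0) else SOME q. adjacent (0, 0) q \<and> q \<notin> hd bs)" for bs
  have "\<exists>n. (\<forall>k<n. maker_legal \<sigma> b k) \<and> (\<exists>P\<in>{S_poly 2}. P \<sqsubseteq> maker_cells \<sigma> b n)"
    if legal: "\<forall>k. breaker_legal \<sigma> b k" for b
  proof -
    have card: "card (b 0) = 2" using legal by (auto simp: breaker_legal_def)
    have "\<exists>q. adjacent (0, 0) q \<and> q \<notin> b 0"
    proof (rule ccontr)
      assume "\<not> ?thesis"
      \<comment> \<open>Three of the four neighbours already exceed the two cells of a
        reply.\<close>
      then have "{(1, 0), (0, 1), (-1, 0)} \<subseteq> b 0" by (auto simp: adjacent_def)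
      then have "card {(1, 0), (0, 1), (-1 :: int, 0 :: int)} \<le> card (b 0)"
        using card by (intro card_mono) (auto intro: card_ge_0_finite)
      then show False using card by simp
    qed
    moreover have moves: "maker_move \<sigma> b 0 = (0, 0)"
      "maker_move \<sigma> b 1 = (SOME q. adjacent (0, 0) q \<and> q \<notin> b 0)"
      by (simp_all add: maker_move_def \<sigma>_def)
    ultimately have m1: "adjacent (0, 0) (maker_move \<sigma> b 1)" "maker_move \<sigma> b 1 \<notin> b 0"
      by (metis (mono_tags, lifting) someI_ex)+
    have "maker_legal \<sigma> b 0"
      by (simp add: maker_legal_def maker_cells_def breaker_cells_def)
    moreover have "maker_legal \<sigma> b 1"
      using m1 moves(1)
      by (auto simp: maker_legal_def maker_cells_def breaker_cells_def adjacent_def)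
    ultimately have "\<forall>k<2. maker_legal \<sigma> b k" by (auto simp: less_2_cases_iff)
    moreover have "S_poly 2 \<sqsubseteq> maker_cells \<sigma> b 2"
      by (rule S2_ancestor[OF _ _ m1(1)]) (auto simp: maker_cells_def moves(1) [symmetric])
    ultimately show ?thesis by blast
  qed
  then show ?thesis unfolding winning_strategy_iff by blast
qed

section \<open>Pairing strategies of the breaker\<close>

lemma card_2_superset_avoiding:
  fixes A D :: "cell set"
  assumes "finite A" "finite D" "card D \<le> 2"
  obtains B where "card B = 2" "B \<inter> A = {}" "D \<subseteq> B \<union> A"
proof -
  have "infinite (UNIV :: cell set)" by (simp add: finite_prod infinite_UNIV_int)
  then have "infinite (- (A \<union> D))" using assms(1,2) by (simp add: Compl_eq_Diff_UNIV)
  \<comment> \<open>The breaker has to mark exactly two cells, so a reply with fewer than two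
    unmarked wanted cells is padded with arbitrary fresh ones.\<close>
  then obtain C where C: "finite C" "card C = 2 - card (D - A)" "C \<subseteq> - (A \<union> D)"
    using infinite_arbitrarily_large by metis
  have "card (D - A) \<le> 2"
    using card_mono[OF assms(2), of "D - A"] assms(3) by auto
  then have "card ((D - A) \<union> C) = 2"
    using C assms(2) by (subst card_Un_disjoint) auto
  then show thesis using C(3) by (intro that[of "(D - A) \<union> C"]) auto
qed

text \<open>Turns a local rule, "after the cell \<open>c\<close>, see to it that all of
  \<open>D c\<close> is marked", into an infinite legal sequence of replies against
  \<open>\<sigma>\<close>, by recursion on the history.\<close>

lemma breaker_reply_play:
  fixes \<sigma> :: strategy and D :: "cell \<Rightarrow> cell set"
  assumes D: "\<And>c. finite (D c)" "\<And>c. card (D c) \<le> 2"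
  obtains b where "\<And>k. breaker_legal \<sigma> b k"
    "\<And>k. D (maker_move \<sigma> b k) \<subseteq> maker_cells \<sigma> b (Suc k) \<union> breaker_cells b (Suc k)"
proof -
  define marked where
    \<comment> \<open>When the breaker is to reply to the history \<open>h\<close>, the maker is one
      move ahead; hence the index \<open>length h\<close> is included.\<close>
    "marked h = (\<lambda>i. \<sigma> (take i h)) ` {..length h} \<union> \<Union> (set h)" for h :: "cell set list"
  define reply_to where
    "reply_to h B \<longleftrightarrow> card B = 2 \<and> B \<inter> marked h = {} \<and> D (\<sigma> h) \<subseteq> B \<union> marked h" for h B
  \<comment> \<open>Here \<open>h\<close> is any list of sets, and infinite ones might leave no free
    cell. The guard allows a choice function on all lists; \<open>fin\<close> discharges it for
    actual histories.\<close>
  have "\<exists>B. (\<forall>X\<in>set h. finite X) \<longrightarrow> reply_to h B" for h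
  proof (cases "\<forall>X\<in>set h. finite X")
    case True
    then have "finite (marked h)" by (auto simp: marked_def)
    then show ?thesis
      using card_2_superset_avoiding[OF _ D, of "marked h"] unfolding reply_to_def by metis
  qed blast
  then obtain resp where resp: "\<And>h. \<forall>X\<in>set h. finite X \<Longrightarrow> reply_to h (resp h)"
    by metis
  define hist where "hist = rec_nat [] (\<lambda>_ h. h @ [resp h])"
  define b where "b k = resp (hist k)" for k
  have hist: "map b [0..<k] = hist k" for k
    by (induction k) (simp_all add: hist_def b_def)
  have fin: "\<forall>X\<in>set (hist k). finite X" for k
  proof (induction k)
    case (Suc k)
    have "finite (resp (hist k))"
      using resp[OF Suc] by (auto simp: reply_to_def intro: card_ge_0_finite)
    then show ?case using Suc by (simp add: hist_def)
  qed (simp add: hist_def)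
  have len: "length (hist k) = k" for k by (simp flip: hist)
  have take: "take i (hist k) = hist i" if "i \<le> k" for i k
    using that by (simp flip: hist add: take_map)
  have "\<sigma> (take i (hist k)) = maker_move \<sigma> b i" if "i \<le> k" for i k
    using that by (simp add: take maker_move_def hist)
  then have "(\<lambda>i. \<sigma> (take i (hist k))) ` {..k} = maker_cells \<sigma> b (Suc k)" for k
    unfolding maker_cells_def lessThan_Suc_atMost by (intro image_cong) auto
  moreover have "\<Union> (set (hist k)) = breaker_cells b k" for k
    unfolding breaker_cells_def hist[symmetric] by (simp add: atLeast0LessThan)
  ultimately have marked: "marked (hist k) = maker_cells \<sigma> b (Suc k) \<union> breaker_cells b k" for k
    by (simp add: marked_def len)
  have r: "reply_to (hist k) (b k)" for k
    unfolding b_def by (rule resp[OF fin])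
  have move: "maker_move \<sigma> b k = \<sigma> (hist k)" for k by (simp add: maker_move_def hist)
  have "breaker_cells b (Suc k) = b k \<union> breaker_cells b k" for k
    by (simp add: breaker_cells_def lessThan_Suc)
  with r marked move show thesis
    by (intro that[of b]) (fastforce simp: reply_to_def breaker_legal_def)+
qed

text \<open>Once the maker marks a cell, all its partners are marked by the end of that round, so he
  cannot legally take one later. Owning two partners would require exactly that for the later of the
  two.\<close>

lemma pairing_not_winning:
  fixes D :: "cell \<Rightarrow> cell set"
  assumes D: "\<And>c. finite (D c)" "\<And>c. card (D c) \<le> 2"
    and sym: "\<And>p q. q \<in> D p \<Longrightarrow> p \<in> D q"
    and pair: "\<And>f P. f \<in> board_symmetries \<Longrightarrow> P \<in> S \<Longrightarrow> \<exists>p\<in>f ` P. \<exists>q\<in>f ` P. p \<noteq> q \<and> q \<in> D p"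
  shows "\<not> winning_strategy S \<sigma>"
proof
  assume win: "winning_strategy S \<sigma>"
  obtain b where b: "\<And>k. breaker_legal \<sigma> b k"
    "\<And>k. D (maker_move \<sigma> b k) \<subseteq> maker_cells \<sigma> b (Suc k) \<union> breaker_cells b (Suc k)"
    by (rule breaker_reply_play[where D = D and \<sigma> = \<sigma>, OF D]) blast
  obtain n P where n: "\<forall>k<n. maker_legal \<sigma> b k" and "P \<in> S" "P \<sqsubseteq> maker_cells \<sigma> b n"
    using win b(1) unfolding winning_strategy_iff by meson
  then obtain p q where pq: "p \<in> maker_cells \<sigma> b n" "q \<in> maker_cells \<sigma> b n" "p \<noteq> q" "q \<in> D p"
    using pair by (meson ancestorE subsetD)
  have no_later: "maker_move \<sigma> b j \<notin> D (maker_move \<sigma> b i)" if "i < j" "j < n" for i j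
  proof
    assume "maker_move \<sigma> b j \<in> D (maker_move \<sigma> b i)"
    then have "maker_move \<sigma> b j \<in> maker_cells \<sigma> b (Suc i) \<union> breaker_cells b (Suc i)"
      using b(2) by blast
    moreover have "maker_cells \<sigma> b (Suc i) \<subseteq> maker_cells \<sigma> b j"
      "breaker_cells b (Suc i) \<subseteq> breaker_cells b j"
      using that by (force simp: maker_cells_def breaker_cells_def)+
    ultimately have "maker_move \<sigma> b j \<in> maker_cells \<sigma> b j \<union> breaker_cells b j" by blast
    then show False using n that by (simp add: maker_legal_def)
  qed
  obtain i j where "i < n" "p = maker_move \<sigma> b i" "j < n" "q = maker_move \<sigma> b j"
    using pq unfolding maker_cells_def by blast
  \<comment> \<open>The moves \<open>i\<close> and \<open>j\<close> differ because \<open>p\<close>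
    and \<open>q\<close> do; if \<open>j\<close> comes first, \<open>sym\<close> exchanges the
    roles.\<close>
  then show False
    using no_later pq(3,4) sym by (metis linorder_neqE_nat)
qed

lemma S3_not_winning: "\<not> winning_strategy {S_poly 3} \<sigma>"
proof -
  \<comment> \<open>\<open>m\<close> swaps the two members of each pair {2k, 2k + 1}. Applied to
    either coordinate it gives the domino partitions of the rows and of the columns.\<close>
  define m :: "int \<Rightarrow> int" where "m x = (if even x then x + 1 else x - 1)" for x
  have m_m: "m (m x) = x" for x by (auto simp: m_def)
  \<comment> \<open>Of three consecutive integers, the middle one is paired with one of the other
    two.\<close>
  have m_cover: "m x = x + a \<or> m (x + a) = x + 2 * a" if "\<bar>a\<bar> = 1" for x a
    using that by (auto simp: m_def abs_if split: if_splits)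
  show ?thesis
  proof (rule pairing_not_winning[where D = "\<lambda>c. {(m (fst c), snd c), (fst c, m (snd c))}"])
    fix f P assume "f \<in> board_symmetries" "P \<in> {S_poly 3}"
    then obtain x y a b c d where f:
      "\<And>p. f p = (x + a * fst p + b * snd p, y + c * fst p + d * snd p)"
      "b = 0 \<and> c = 0 \<and> \<bar>a\<bar> = 1 \<and> \<bar>d\<bar> = 1 \<or> a = 0 \<and> d = 0 \<and> \<bar>b\<bar> = 1 \<and> \<bar>c\<bar> = 1"
      and P: "P = S_poly 3"
      by (elim board_symmetries_affine) auto
    have img: "f ` P = {(x, y), (x + a, y + c), (x + 2 * a, y + 2 * c)}"
      by (simp add: P S_poly_numeral f(1) mult.commute)
    show "\<exists>p\<in>f ` P. \<exists>q\<in>f ` P.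
            p \<noteq> q \<and> q \<in> {(m (fst p), snd p), (fst p, m (snd p))}"
      using f(2)
    proof (elim disjE)
      assume *: "b = 0 \<and> c = 0 \<and> \<bar>a\<bar> = 1 \<and> \<bar>d\<bar> = 1"
      then have "m x = x + a \<or> m (x + a) = x + 2 * a" using m_cover by blast
      with * show ?thesis unfolding img by fastforce
    next
      assume *: "a = 0 \<and> d = 0 \<and> \<bar>b\<bar> = 1 \<and> \<bar>c\<bar> = 1"
      then have "m y = y + c \<or> m (y + c) = y + 2 * c" using m_cover by blast
      with * show ?thesis unfolding img by fastforce
    qed
  qed (auto simp: m_m card_insert_if)
qed

text \<open>The two arms of a bent tromino are perpendicular, so one of them is horizontal and joins
  the corner cell to a partner.\<close>

lemma L2_not_winning: "\<not> winning_strategy {L2_poly} \<sigma>"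
proof (rule pairing_not_winning[where D = "\<lambda>c. {(fst c - 1, snd c), (fst c + 1, snd c)}"])
  fix f P assume "f \<in> board_symmetries" "P \<in> {L2_poly}"
  then obtain x y a b c d where f:
    "\<And>p. f p = (x + a * fst p + b * snd p, y + c * fst p + d * snd p)"
    "b = 0 \<and> c = 0 \<and> \<bar>a\<bar> = 1 \<and> \<bar>d\<bar> = 1 \<or> a = 0 \<and> d = 0 \<and> \<bar>b\<bar> = 1 \<and> \<bar>c\<bar> = 1"
    and P: "P = L2_poly"
    by (elim board_symmetries_affine) auto
  have img: "f ` P = {(x, y), (x + a, y + c), (x + b, y + d)}"
    by (simp add: P L2_poly_def f(1))
  show "\<exists>p\<in>f ` P. \<exists>q\<in>f ` P. p \<noteq> q \<and> q \<in> {(fst p - 1, snd p), (fst p + 1, snd p)}"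
    using f(2)
  proof (elim disjE)
    \<comment> \<open>Here the image of (1, 0) is the horizontal neighbour of the corner; in the
      other case it is the image of (0, 1).\<close>
    assume *: "b = 0 \<and> c = 0 \<and> \<bar>a\<bar> = 1 \<and> \<bar>d\<bar> = 1"
    then have "a = 1 \<or> a = -1" by arith
    with * show ?thesis unfolding img by force
  next
    assume *: "a = 0 \<and> d = 0 \<and> \<bar>b\<bar> = 1 \<and> \<bar>c\<bar> = 1"
    then have "b = 1 \<or> b = -1" by arith
    with * show ?thesis unfolding img by force
  qed
qed auto

section \<open>Teams of size 1 and the characterization\<close>

lemma cell_connected_star:
  assumes "p \<in> P" "\<And>q. q \<in> P \<Longrightarrow> q = p \<or> adjacent p q"
  shows "cell_connected P"
proof -
  let ?E = "{(u, v). u \<in> P \<and> v \<in> P \<and> adjacent u v}"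
  have "(p, q) \<in> ?E\<^sup>*" "(q, p) \<in> ?E\<^sup>*" if "q \<in> P" for q
    using assms(1) assms(2)[OF that] that adjacent_sym[of p q] by auto
  then show ?thesis unfolding cell_connected_def by (meson rtrancl_trans)
qed

lemma polyomino_examples:
  "polyomino (S_poly 2)" "polyomino (S_poly 3)" "polyomino L2_poly"
proof -
  have "cell_connected (S_poly 2)" "cell_connected L2_poly"
    by (rule cell_connected_star[of "(0, 0)"];
        force simp: adjacent_def S_poly_numeral L2_poly_def)+
  moreover have "cell_connected (S_poly 3)"
    \<comment> \<open>The centre of the star is the middle cell of the straight tromino.\<close>
    by (rule cell_connected_star[of "(1, 0)"]) (force simp: adjacent_def S_poly_numeral)+
  ultimately show "polyomino (S_poly 2)" "polyomino (S_poly 3)" "polyomino L2_poly"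
    by (simp_all add: polyomino_def) (simp_all add: S_poly_numeral L2_poly_def)
qed

lemma finite_examples: "finite (S_poly 2)" "finite (S_poly 3)" "finite L2_poly"
  by (simp_all add: S_poly_numeral L2_poly_def)

lemma team_singleton: "team {P} \<longleftrightarrow> polyomino P"
  by (simp add: team_def)

lemma simpler_singletons: "{P} \<preceq> {Q} \<longleftrightarrow> P \<sqsubseteq> Q"
  by (simp add: simpler_def)

lemma winner_singleton_finite:
  "finite P \<Longrightarrow> winner {P} \<longleftrightarrow> (\<exists>\<sigma>. winning_strategy {P} \<sigma>)"
  by (simp add: winner_def unbounded_def)

text \<open>For finite \<open>P\<close>, a strategy that completes \<open>P\<close> completes
  \<open>Q\<close> as well. For infinite \<open>P\<close>, the set \<open>{Q}\<close> is itself a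
  bounded restriction of \<open>{P}\<close>.\<close>

lemma winner_ancestor:
  assumes "winner {P}" "Q \<sqsubseteq> P" "polyomino Q" "finite Q"
  shows "winner {Q}"
proof (cases "finite P")
  case True
  then obtain \<sigma> where "winning_strategy {P} \<sigma>"
    using assms(1) winner_singleton_finite by blast
  then have "winning_strategy {Q} \<sigma>"
    using winning_strategy_simpler assms(2) simpler_singletons by blast
  then show ?thesis
    using assms(4) winner_singleton_finite by blast
next
  case False
  have "bounded_restriction {P} {Q}"
    unfolding bounded_restriction_def using False assms(2-4)
    by (intro conjI exI[of _ "\<lambda>_. Q"]) (simp_all add: unbounded_def)
  then show ?thesis
    using False assms(1,4) by (auto simp: winner_def unbounded_def)
qed

theorem proposition6p1:
  "characterizing_collection 1 {Y1} {N11, N12} \<and>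
   (\<forall>F. team F \<and> card F = 1 \<longrightarrow> (winner F \<longleftrightarrow> F \<preceq> Y1))"
proof -
  have Y1: "winner Y1"
    using S2_winning_strategy by (simp add: Y1_def winner_singleton_finite finite_examples)
  have N: "loser N11" "loser N12"
    using S3_not_winning L2_not_winning
    by (simp_all add: N11_def N12_def winner_singleton_finite finite_examples)
  have teams: "team Y1" "team N11" "team N12"
    by (simp_all add: Y1_def N11_def N12_def team_singleton polyomino_examples)
  have dichotomy: "F \<preceq> Y1 \<or> N11 \<preceq> F \<or> N12 \<preceq> F" if "team F" "card F = 1" for F
  proof -
    obtain P where P: "F = {P}" using \<open>card F = 1\<close> by (rule card_1_singletonE)
    then have "polyomino P" using \<open>team F\<close> by (simp add: team_singleton)
    then show ?thesis
      using polyomino_cases unfolding P Y1_def N11_def N12_def simpler_singletons by blast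
  qed
  have "winner F \<longleftrightarrow> F \<preceq> Y1" if F: "team F" "card F = 1" for F
  proof -
    obtain P where P: "F = {P}" using F(2) card_1_singletonE by blast
    show ?thesis
    proof
      assume "F \<preceq> Y1"
      then have "P \<sqsubseteq> S_poly 2" by (simp add: P Y1_def simpler_singletons)
      moreover have "polyomino P" using F(1) by (simp add: P team_singleton)
      \<comment> \<open>As an ancestor of the domino, \<open>P\<close> is finite, as
        \<open>winner_ancestor\<close> requires.\<close>
      ultimately show "winner F"
        using Y1 winner_ancestor ancestor_finite finite_examples(1) unfolding P Y1_def by blast
    next
      assume "winner F"
      \<comment> \<open>Otherwise the win would pass down from \<open>P\<close>, finite or infinite,
        to a losing tromino.\<close>
      then have "\<not> N11 \<preceq> F" "\<not> N12 \<preceq> F"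
        using N winner_ancestor polyomino_examples finite_examples
        unfolding P N11_def N12_def simpler_singletons by blast+
      then show "F \<preceq> Y1" using dichotomy F by blast
    qed
  qed
  moreover have "characterizing_collection 1 {Y1} {N11, N12}"
    unfolding characterizing_collection_def using Y1 N teams dichotomy by blast
  ultimately show ?thesis by blast
qed

end
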